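(* Let $d\geq 2$. For $0\leq j<d$, let nonzero numbers $0\neq\eta_j\in\mathbb{C}$ be prescribed. Assume $$\sum_{j=0}^{d-1}\eta_j=0,\qquad\text{and also}\qquad \sum_{j\in J}\eta_j\neq 0\quad\text{for every nonempty proper subset } \emptyset\neq J\subsetneq\{0,\ldots,d-1\}.$$ Then there exists a monic complex polynomial $$f(w)=(w-e_0)\cdot\ldots\cdot(w-e_{d-1})$$ of degree $d$ with $d$ simple (pairwise distinct) complex zeros $e_0,\ldots,e_{d-1}$, such that $f'(e_j)=1/\eta_j$ for all $0\leq j<d$.
   Context: The polynomial $f$ is normalized to have leading coefficient $1$. The locations of the zeros $e_j$ are not prescribed. *)

theory Defs
  imports Complex_Main "HOL-Computational_Algebra.Polynomial"
begin

end

(* If eta_j = 1/f'(e_j) for a polynomial f of degree d with zeros e_j, then the sums of eta_j p(e_j)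
   vanish for all p of degree at most d - 2. Conversely, let a nonconstant e satisfy these conditions.
   Grouping equal e_j and testing against the product of x - c over the other values c would make a
   proper subset sum of eta vanish if two of the e_j were equal; so the e_j are distinct. Testing
   against products of d - 2 factors then shows that eta_j f'(e_j) does not depend on j, and a
   rescaling of e makes this constant 1.

   Such an e exists by continuation along the complex line through (rho_0, ..., rho_(d-1)), where
   rho_j are the d-th roots of unity (there e = rho works), and eta. The line meets the subset sum
   hyperplanes in finitely many points only, because eta avoids all of them, so the remaining
   parameters are connected. Solvability is closed, since e can be normalised to a compact set by
   affine maps, and it is open: near a solution with distinct e_j, fix e_0 and e_1 and minimise the
   sum of squares of the power sums over a small box. An interior minimiser with nonzero residual
   is impossible, as Lagrange interpolation yields a Newton direction; minimisers on the boundary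
   are excluded because the given solution is isolated. *)

theory Submission
  imports Defs "HOL-Analysis.Analysis"
begin

section \<open>Weights annihilating polynomials of low degree\<close>

definition annihilates :: "nat \<Rightarrow> (nat \<Rightarrow> complex) \<Rightarrow> (nat \<Rightarrow> complex) \<Rightarrow> bool" where
  "annihilates d \<eta> e \<longleftrightarrow> (\<forall>p. degree p + 2 \<le> d \<longrightarrow> (\<Sum>j<d. \<eta> j * poly p (e j)) = 0)"

lemma annihilates_iff_power_sums:
  "annihilates d \<eta> e \<longleftrightarrow> (\<forall>k. k + 2 \<le> d \<longrightarrow> (\<Sum>j<d. \<eta> j * e j ^ k) = 0)"
proof
  assume a: "annihilates d \<eta> e"
  have "(\<Sum>j<d. \<eta> j * e j ^ k) = 0" if "k + 2 \<le> d" for k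
    using a[unfolded annihilates_def, rule_format, of "monom 1 k"] that
    by (simp add: degree_monom_eq poly_monom)
  then show "\<forall>k. k + 2 \<le> d \<longrightarrow> (\<Sum>j<d. \<eta> j * e j ^ k) = 0" by blast
next
  assume a: "\<forall>k. k + 2 \<le> d \<longrightarrow> (\<Sum>j<d. \<eta> j * e j ^ k) = 0"
  show "annihilates d \<eta> e"
    unfolding annihilates_def
  proof (intro allI impI)
    fix p :: "complex poly" assume p: "degree p + 2 \<le> d"
    have "(\<Sum>j<d. \<eta> j * poly p (e j)) = (\<Sum>j<d. \<Sum>k\<le>degree p. coeff p k * (\<eta> j * e j ^ k))"
      by (simp add: poly_altdef sum_distrib_left mult_ac)
    also have "\<dots> = (\<Sum>k\<le>degree p. coeff p k * (\<Sum>j<d. \<eta> j * e j ^ k))"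
      by (subst sum.swap) (simp add: sum_distrib_left)
    also have "\<dots> = 0"
      using a p by (intro sum.neutral) auto
    finally show "(\<Sum>j<d. \<eta> j * poly p (e j)) = 0" .
  qed
qed

text \<open>Composing with an affine map does not raise the degree of a test polynomial. This
  freedom allows the nodes to be normalised in \<open>annihilates_closed\<close>.\<close>

lemma annihilates_affine:
  assumes "annihilates d \<eta> e"
  shows "annihilates d \<eta> (\<lambda>j. a + b * e j)"
  unfolding annihilates_def
proof (intro allI impI)
  fix p :: "complex poly" assume "degree p + 2 \<le> d"
  moreover have "degree (pcompose p [:a, b:]) \<le> degree p"
    by (simp add: degree_pcompose)
  ultimately have "(\<Sum>j<d. \<eta> j * poly (pcompose p [:a, b:]) (e j)) = 0"
    using assms unfolding annihilates_def by auto
  then show "(\<Sum>j<d. \<eta> j * poly p (a + b * e j)) = 0"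
    by (simp add: poly_pcompose mult.commute)
qed

lemma annihilates_cong:
  assumes "\<And>j. j < d \<Longrightarrow> e j = e' j"
  shows "annihilates d \<eta> e \<longleftrightarrow> annihilates d \<eta> e'"
  using assms unfolding annihilates_def by simp

section \<open>Antiderivatives and Lagrange interpolation\<close>

lemma pderiv_sum: "pderiv (sum f A) = (\<Sum>x\<in>A. pderiv (f x))"
  using higher_pderiv_sum[of 1] by simp

lemma poly_antiderivative:
  fixes q :: "'a :: field_char_0 poly"
  obtains p where "pderiv p = q" "degree p \<le> degree q + 1"
proof
  let ?p = "\<Sum>k\<le>degree q. monom (coeff q k / of_nat (Suc k)) (Suc k)"
  have "pderiv ?p = (\<Sum>k\<le>degree q. monom (coeff q k) k)"
    by (simp add: pderiv_sum pderiv_monom del: of_nat_Suc)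
  then show "pderiv ?p = q"
    by (simp add: poly_as_sum_of_monoms)
  show "degree ?p \<le> degree q + 1"
    by (intro degree_sum_le) (auto intro: order_trans[OF degree_monom_le])
qed

lemma lagrange_interpolation:
  fixes p :: "'a :: field poly"
  assumes "inj_on x I" "degree p < card I"
  shows "p = (\<Sum>i\<in>I. smult (poly p (x i) / (\<Prod>l\<in>I - {i}. x i - x l)) (\<Prod>l\<in>I - {i}. [:- x l, 1:]))"
proof (rule poly_eqI_degree[where A = "x ` I"])
  have fin: "finite I" using assms(2) card.infinite by fastforce
  show "card (x ` I) > degree p" using assms by (simp add: card_image)
  have "degree (\<Sum>i\<in>I. smult (poly p (x i) / (\<Prod>l\<in>I - {i}. x i - x l)) (\<Prod>l\<in>I - {i}. [:- x l, 1:]))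
      \<le> card I - 1"
  proof (intro degree_sum_le fin)
    fix i assume "i \<in> I"
    have "degree (\<Prod>l\<in>I - {i}. [:- x l, 1:]) \<le> (\<Sum>l\<in>I - {i}. 1)"
      by (rule order_trans[OF degree_prod_sum_le]) (use fin in auto)
    also have "\<dots> = card I - 1" using fin \<open>i \<in> I\<close> by simp
    finally show "degree (smult (poly p (x i) / (\<Prod>l\<in>I - {i}. x i - x l)) (\<Prod>l\<in>I - {i}. [:- x l, 1:]))
        \<le> card I - 1"
      using degree_smult_le order_trans by blast
  qed
  then show "degree (\<Sum>i\<in>I. smult (poly p (x i) / (\<Prod>l\<in>I - {i}. x i - x l)) (\<Prod>l\<in>I - {i}. [:- x l, 1:]))
      < card (x ` I)"
    using assms by (simp add: card_image)
  fix z assume "z \<in> x ` I"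
  then obtain m where m: "m \<in> I" "z = x m" by blast
  have nz: "(\<Prod>l\<in>I - {m}. x m - x l) \<noteq> 0"
    using m fin assms(1) by (auto simp: prod_zero_iff inj_on_def)
  have "poly (\<Sum>i\<in>I. smult (poly p (x i) / (\<Prod>l\<in>I - {i}. x i - x l)) (\<Prod>l\<in>I - {i}. [:- x l, 1:])) z
      = (\<Sum>i\<in>I. if i = m then poly p z else 0)"
    unfolding poly_sum
  proof (intro sum.cong refl)
    fix i assume "i \<in> I"
    show "poly (smult (poly p (x i) / (\<Prod>l\<in>I - {i}. x i - x l)) (\<Prod>l\<in>I - {i}. [:- x l, 1:])) z
      = (if i = m then poly p z else 0)"
    proof (cases "i = m")
      case True
      then show ?thesis using nz m by (simp add: poly_prod)
    next
      case False
      then have "poly (\<Prod>l\<in>I - {i}. [:- x l, 1:]) z = 0"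
        using m fin by (auto simp: poly_prod prod_zero_iff)
      then show ?thesis using False by simp
    qed
  qed
  then show "poly p z = poly (\<Sum>i\<in>I. smult (poly p (x i) / (\<Prod>l\<in>I - {i}. x i - x l)) (\<Prod>l\<in>I - {i}. [:- x l, 1:])) z"
    using m fin by simp
qed

text \<open>The node product has degree \<open>d - 3\<close>, so its antiderivative just meets the
  degree bound of \<open>annihilates\<close>. Among the free nodes, such a test polynomial responds
  to first order only to node \<open>i\<close>, because its derivative vanishes at the
  others.\<close>

lemma node_prod_antiderivative:
  fixes x :: "nat \<Rightarrow> complex"
  assumes "i \<in> {2..<d}"
  obtains p where "pderiv p = (\<Prod>l\<in>{2..<d} - {i}. [:- x l, 1:])" "degree p + 2 \<le> d"
proof -
  obtain p where p: "pderiv p = (\<Prod>l\<in>{2..<d} - {i}. [:- x l, 1:])"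
    "degree p \<le> degree (\<Prod>l\<in>{2..<d} - {i}. [:- x l, 1:]) + 1"
    using poly_antiderivative by blast
  have "degree (\<Prod>l\<in>{2..<d} - {i}. [:- x l, 1:]) \<le> (\<Sum>l\<in>{2..<d} - {i}. 1)"
    by (rule order_trans[OF degree_prod_sum_le]) auto
  then show thesis using p assms by (intro that) auto
qed

section \<open>Linearisation in the free nodes\<close>

text \<open>Nodes 0 and 1 stay fixed, leaving \<open>d - 2\<close> unknown velocities. Constants are
  annihilated by \<open>s\<close>, so the linearised equations only have to be met on the
  \<open>d - 2\<close> test polynomials \<open>P i\<close>, where they decouple.\<close>

lemma newton_direction:
  fixes \<eta> x :: "nat \<Rightarrow> complex"
  assumes inj: "inj_on x {2..<d}" and nz: "\<And>j. j \<in> {2..<d} \<Longrightarrow> \<eta> j \<noteq> 0" and s: "(\<Sum>j<d. \<eta> j) = 0"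
  obtains v where "\<And>j. j \<notin> {2..<d} \<Longrightarrow> v j = 0"
    "\<And>p. degree p + 2 \<le> d \<Longrightarrow>
      (\<Sum>j<d. \<eta> j * (poly (pderiv p) (x j) * v j)) = - (\<Sum>j<d. \<eta> j * poly p (x j))"
proof -
  let ?I = "{2..<d}"
  let ?c = "\<lambda>i. \<Prod>l\<in>?I - {i}. x i - x l"
  let ?F = "\<lambda>p. \<Sum>j<d. \<eta> j * poly p (x j)"
  have "\<forall>i\<in>?I. \<exists>p. pderiv p = (\<Prod>l\<in>?I - {i}. [:- x l, 1:]) \<and> degree p + 2 \<le> d"
    using node_prod_antiderivative by metis
  then obtain P where P: "\<And>i. i \<in> ?I \<Longrightarrow> pderiv (P i) = (\<Prod>l\<in>?I - {i}. [:- x l, 1:])"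
    by metis
  \<comment> \<open>For the test polynomial \<open>P j\<close> the left side of the linearised
    equation reduces to \<open>\<eta> j * ?c j * v j\<close>, which dictates this value.\<close>
  define v where "v j = (if j \<in> ?I then - ?F (P j) / (\<eta> j * ?c j) else 0)" for j
  have *: "(\<Sum>j<d. \<eta> j * (poly (pderiv p) (x j) * v j)) = - ?F p" if deg: "degree p + 2 \<le> d" for p
  proof -
    \<comment> \<open>Interpolating the derivative of \<open>p\<close> expresses \<open>p\<close> by the \<open>P i\<close> up to a constant, which the
      weights annihilate.\<close>
    define a where "a i = poly (pderiv p) (x i) / ?c i" for i
    have pd: "pderiv p = (\<Sum>i\<in>?I. smult (a i) (\<Prod>l\<in>?I - {i}. [:- x l, 1:]))"
    \<comment> \<open>Constants are treated apart because of \<open>d = 2\<close>: there are then no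
      free nodes, and not even the zero derivative has degree below their number.\<close>
    proof (cases "degree p = 0")
      case True
      then have "pderiv p = 0" by (simp add: pderiv_eq_0_iff)
      then show ?thesis by (simp add: a_def)
    next
      case False
      then show ?thesis
        unfolding a_def using inj deg by (intro lagrange_interpolation) (auto simp: degree_pderiv)
    qed
    have "pderiv (p - (\<Sum>i\<in>?I. smult (a i) (P i))) = 0"
      unfolding pderiv_diff pderiv_sum pderiv_smult
      by (subst pd) (simp add: P)
    then obtain h where h: "p = (\<Sum>i\<in>?I. smult (a i) (P i)) + [:h:]"
      by (metis pderiv_iszero diff_add_cancel add.commute)
    have "?F p = (\<Sum>j<d. \<Sum>i\<in>?I. a i * (\<eta> j * poly (P i) (x j))) + (\<Sum>j<d. \<eta> j) * h"
    proof -
      have "\<eta> j * poly p (x j) = (\<Sum>i\<in>?I. a i * (\<eta> j * poly (P i) (x j))) + \<eta> j * h" for j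
        by (simp add: h poly_sum algebra_simps sum_distrib_left)
      then show ?thesis by (simp add: sum.distrib sum_distrib_right)
    qed
    also have "\<dots> = (\<Sum>i\<in>?I. a i * ?F (P i))"
      using s by (subst sum.swap) (simp add: sum_distrib_left)
    also have "\<dots> = - (\<Sum>j\<in>?I. \<eta> j * (poly (pderiv p) (x j) * v j))"
      unfolding sum_negf[symmetric] using nz by (intro sum.cong refl) (auto simp: v_def a_def)
    also have "(\<Sum>j\<in>?I. \<eta> j * (poly (pderiv p) (x j) * v j)) = (\<Sum>j<d. \<eta> j * (poly (pderiv p) (x j) * v j))"
      by (rule sum.mono_neutral_left) (auto simp: v_def)
    finally show ?thesis by simp
  qed
  show thesis
  proof (rule that)
    show "v j = 0" if "j \<notin> ?I" for j
      using that unfolding v_def by (rule if_not_P)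
  qed (rule *)
qed

text \<open>Subtracting the equations of \<open>x\<close> and \<open>e\<close> for the test
  polynomial \<open>P i\<close> leaves \<open>c i * (x i - e i)\<close> plus first-order Taylor
  errors. In a small enough box these errors are too small to balance a nonzero
  displacement.\<close>

lemma annihilated_isolated:
  fixes \<eta> e :: "nat \<Rightarrow> complex"
  assumes inj: "inj_on e {2..<d}" and nz: "\<And>j. j \<in> {2..<d} \<Longrightarrow> \<eta> j \<noteq> 0" and ann: "annihilates d \<eta> e"
  shows "\<forall>\<^sub>F r in at_right 0. \<forall>x. (\<forall>j. j \<notin> {2..<d} \<longrightarrow> x j = e j) \<longrightarrow>
    (\<forall>j\<in>{2..<d}. dist (x j) (e j) \<le> r) \<longrightarrow> annihilates d \<eta> x \<longrightarrow> x = e"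
proof -
  let ?I = "{2..<d}"
  let ?q = "\<lambda>i. \<Prod>l\<in>?I - {i}. [:- e l, 1:]"
  have "\<forall>i\<in>?I. \<exists>p. pderiv p = ?q i \<and> degree p + 2 \<le> d"
    using node_prod_antiderivative by metis
  then obtain P where P: "\<And>i. i \<in> ?I \<Longrightarrow> pderiv (P i) = ?q i" "\<And>i. i \<in> ?I \<Longrightarrow> degree (P i) + 2 \<le> d"
    by metis
  define c where "c i = \<eta> i * poly (?q i) (e i)" for i
  have c: "c i \<noteq> 0" if "i \<in> ?I" for i
    using that nz inj by (auto simp: c_def poly_prod prod_zero_iff inj_on_def)
  have q0: "poly (?q i) (e j) = 0" if "i \<in> ?I" "j \<in> ?I" "i \<noteq> j" for i j
    using that by (auto simp: poly_prod prod_zero_iff)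
  define N where "N = (\<Sum>j\<in>?I. norm (\<eta> j))"
  define C where "C = (\<Sum>i\<in>?I. 1 / norm (c i))"
  \<comment> \<open>Chosen to make \<open>\<epsilon> * N * C < 1\<close>; the summand 1 covers the
    case \<open>N * C = 0\<close>.\<close>
  define \<epsilon> where "\<epsilon> = 1 / (2 * (N * C + 1))"
  have NC: "N \<ge> 0" "C \<ge> 0" by (auto simp: N_def C_def intro: sum_nonneg)
  have pos: "N * C + 1 > 0" using NC by (simp add: add_nonneg_pos)
  then have "\<epsilon> > 0" by (simp add: \<epsilon>_def)
  have "\<epsilon> * (2 * (N * C + 1)) = 1" using pos by (simp add: \<epsilon>_def)
  then have eNC: "\<epsilon> * N * C < 1"
    using \<open>\<epsilon> > 0\<close> by (simp add: algebra_simps)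
  have "\<forall>\<^sub>F r in at_right 0. \<forall>y. dist y (e j) \<le> r \<longrightarrow>
     norm (poly (P i) y - poly (P i) (e j) - poly (?q i) (e j) * (y - e j)) \<le> \<epsilon> * norm (y - e j)"
    if "i \<in> ?I" for i j
  proof -
    have "(poly (P i) has_derivative (*) (poly (?q i) (e j))) (at (e j))"
      using poly_DERIV[of "P i" "e j"] P that by (simp add: has_field_derivative_def)
    then obtain \<delta> where "\<delta> > 0" and \<delta>: "\<And>y. norm (y - e j) < \<delta> \<Longrightarrow>
     norm (poly (P i) y - poly (P i) (e j) - poly (?q i) (e j) * (y - e j)) \<le> \<epsilon> * norm (y - e j)"
      using \<open>\<epsilon> > 0\<close> unfolding has_derivative_at_alt by blast
    show ?thesis
      unfolding eventually_at_right_field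
      using \<open>\<delta> > 0\<close> \<delta> by (intro exI[of _ \<delta>]) (auto simp: dist_norm)
  qed
  then have "\<forall>\<^sub>F r in at_right 0. \<forall>i\<in>?I. \<forall>j\<in>?I. \<forall>y. dist y (e j) \<le> r \<longrightarrow>
     norm (poly (P i) y - poly (P i) (e j) - poly (?q i) (e j) * (y - e j)) \<le> \<epsilon> * norm (y - e j)"
    by (intro eventually_ball_finite ballI) auto
  then show ?thesis
  proof (rule eventually_mono, intro allI impI)
    fix r x
    assume taylor: "\<forall>i\<in>?I. \<forall>j\<in>?I. \<forall>y. dist y (e j) \<le> r \<longrightarrow>
     norm (poly (P i) y - poly (P i) (e j) - poly (?q i) (e j) * (y - e j)) \<le> \<epsilon> * norm (y - e j)"
      and out: "\<forall>j. j \<notin> ?I \<longrightarrow> x j = e j" and close: "\<forall>j\<in>?I. dist (x j) (e j) \<le> r"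
      and x: "annihilates d \<eta> x"
    define T where "T = (\<Sum>j\<in>?I. norm (x j - e j))"
    have T0: "T \<ge> 0" by (simp add: T_def sum_nonneg)
    have each: "norm (x i - e i) \<le> 1 / norm (c i) * (\<epsilon> * N * T)" if i: "i \<in> ?I" for i
    proof -
      define R where "R j = poly (P i) (x j) - poly (P i) (e j) - poly (?q i) (e j) * (x j - e j)" for j
      have "(\<Sum>j<d. \<eta> j * poly (P i) (x j)) = 0" "(\<Sum>j<d. \<eta> j * poly (P i) (e j)) = 0"
        using x ann P(2)[OF i] unfolding annihilates_def by auto
      then have "(\<Sum>j<d. \<eta> j * (poly (P i) (x j) - poly (P i) (e j))) = 0"
        by (simp add: algebra_simps sum_subtractf)
      moreover have "(\<Sum>j<d. \<eta> j * (poly (P i) (x j) - poly (P i) (e j)))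
          = (\<Sum>j\<in>?I. \<eta> j * (poly (P i) (x j) - poly (P i) (e j)))"
        by (rule sum.mono_neutral_right) (use out in auto)
      moreover have "(\<Sum>j\<in>?I. \<eta> j * (poly (P i) (x j) - poly (P i) (e j)))
          = (\<Sum>j\<in>?I. \<eta> j * R j) + (\<Sum>j\<in>?I. \<eta> j * (poly (?q i) (e j) * (x j - e j)))"
        by (simp add: R_def sum.distrib[symmetric] algebra_simps)
      moreover have "(\<Sum>j\<in>?I. \<eta> j * (poly (?q i) (e j) * (x j - e j)))
          = (\<Sum>j\<in>?I. if j = i then c i * (x i - e i) else 0)"
        by (intro sum.cong refl) (use q0 i in \<open>auto simp: c_def\<close>)
      ultimately have "c i * (x i - e i) = - (\<Sum>j\<in>?I. \<eta> j * R j)"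
        using i by (simp add: eq_neg_iff_add_eq_0 add.commute)
      then have "norm (c i) * norm (x i - e i) = norm (\<Sum>j\<in>?I. \<eta> j * R j)"
        by (simp only: norm_mult[symmetric] norm_minus_cancel)
      also have "\<dots> \<le> (\<Sum>j\<in>?I. norm (\<eta> j) * (\<epsilon> * T))"
      proof (rule sum_norm_le)
        fix j assume j: "j \<in> ?I"
        have "norm (R j) \<le> \<epsilon> * norm (x j - e j)" unfolding R_def using taylor close i j by blast
        also have "\<dots> \<le> \<epsilon> * T"
          using \<open>\<epsilon> > 0\<close> j by (auto simp: T_def intro!: mult_left_mono member_le_sum)
        finally show "norm (\<eta> j * R j) \<le> norm (\<eta> j) * (\<epsilon> * T)"
          unfolding norm_mult by (rule mult_left_mono) simp
      qed
      also have "\<dots> = \<epsilon> * N * T" by (simp add: N_def sum_distrib_right[symmetric])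
      finally show ?thesis using c[OF i] by (simp add: field_simps)
    qed
    \<comment> \<open>Summing the bounds over the free nodes bounds the total displacement
      \<open>T\<close> by a proper fraction of itself.\<close>
    have "T \<le> (\<Sum>i\<in>?I. 1 / norm (c i) * (\<epsilon> * N * T))"
      unfolding T_def by (rule sum_mono) (rule each[unfolded T_def])
    also have "\<dots> = (\<epsilon> * N * C) * T"
      by (simp only: C_def sum_distrib_right[symmetric]) (simp add: mult_ac)
    finally have "(1 - \<epsilon> * N * C) * T \<le> 0" by (simp add: algebra_simps)
    then have "T = 0" using eNC T0 by (simp add: mult_le_0_iff)
    then have "\<forall>j\<in>?I. x j = e j"
      by (simp add: T_def sum_nonneg_eq_0_iff)
    then show "x = e" using out by (intro ext) blast
  qed
qed


section \<open>Compact boxes and the residual\<close>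

text \<open>Tychonoff's theorem. Nodes are functions on all of \<open>nat\<close>, so the boxes used
  later also confine the coordinates outside the relevant range.\<close>

lemma compact_function_box:
  fixes C :: "'i \<Rightarrow> 'b :: topological_space set"
  assumes "\<And>j. compact (C j)"
  shows "compact {x. \<forall>j. x j \<in> C j}"
proof -
  have "compactin (product_topology (\<lambda>i. euclidean) UNIV) (PiE UNIV C)"
    using assms by (simp add: compactin_PiE)
  moreover have "PiE UNIV C = {x. \<forall>j. x j \<in> C j}" by (auto simp: PiE_def Pi_def)
  ultimately show ?thesis by (simp add: euclidean_product_topology)
qed

text \<open>The range \<open>k < d - 1\<close> is the range \<open>k + 2 \<le> d\<close> for natural subtraction, also for \<open>d = 0\<close>.\<close>

definition residual :: "nat \<Rightarrow> (nat \<Rightarrow> complex) \<Rightarrow> (nat \<Rightarrow> complex) \<Rightarrow> real" where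
  "residual d \<eta> x = (\<Sum>k<d - 1. (norm (\<Sum>j<d. \<eta> j * x j ^ k))\<^sup>2)"

lemma residual_nonneg: "residual d \<eta> x \<ge> 0"
  by (simp add: residual_def sum_nonneg)

lemma residual_eq_0_iff: "residual d \<eta> x = 0 \<longleftrightarrow> annihilates d \<eta> x"
proof -
  have "k < d - 1 \<longleftrightarrow> k + 2 \<le> d" for k by auto
  then show ?thesis
    by (auto simp: residual_def sum_nonneg_eq_0_iff annihilates_iff_power_sums)
qed

lemma continuous_on_residual:
  assumes "continuous_on S f" "continuous_on S g"
  shows "continuous_on S (\<lambda>z. residual d (f z) (g z))"
proof -
  have "continuous_on S (\<lambda>z. f z j)" "continuous_on S (\<lambda>z. g z j)" for j
    by (rule continuous_on_product_then_coordinatewise, rule assms)+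
  then show ?thesis
    unfolding residual_def
    by (intro continuous_on_sum continuous_on_power continuous_on_norm continuous_on_mult)
qed

text \<open>Along \<open>v\<close> each power sum has derivative minus itself, so its squared norm
  has derivative minus twice itself.\<close>

lemma residual_along_newton_direction:
  fixes \<eta> x v :: "nat \<Rightarrow> complex"
  assumes v: "\<And>p. degree p + 2 \<le> d \<Longrightarrow>
      (\<Sum>j<d. \<eta> j * (poly (pderiv p) (x j) * v j)) = - (\<Sum>j<d. \<eta> j * poly p (x j))"
  shows "((\<lambda>s. residual d \<eta> (\<lambda>j. x j + of_real s * v j)) has_real_derivative - 2 * residual d \<eta> x) (at 0)"
proof -
  let ?F = "\<lambda>k. \<Sum>j<d. \<eta> j * x j ^ k"
  let ?f = "\<lambda>k s. \<Sum>j<d. \<eta> j * (x j + of_real s * v j) ^ k"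
  have "((\<lambda>s. (norm (?f k s))\<^sup>2) has_real_derivative - 2 * (norm (?F k))\<^sup>2) (at 0)"
    if "k < d - 1" for k
  proof -
    have "((\<lambda>s. (x j + of_real s * v j) ^ k) has_vector_derivative poly (pderiv (monom 1 k)) (x j) * v j) (at 0)" for j
    proof -
      have a: "((\<lambda>s. x j + of_real s * v j) has_vector_derivative v j) (at 0)"
        by (auto intro!: derivative_eq_intros)
      have b: "(poly (monom 1 k) has_field_derivative poly (pderiv (monom 1 k)) (x j)) (at (x j + of_real 0 * v j))"
        using poly_DERIV[of "monom 1 k" "x j"] by simp
      show ?thesis
        using field_vector_diff_chain_at[OF a b] by (simp add: o_def poly_monom mult.commute)
    qed
    then have "(?f k has_vector_derivative (\<Sum>j<d. \<eta> j * (poly (pderiv (monom 1 k)) (x j) * v j))) (at 0)"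
      by (intro has_vector_derivative_sum has_vector_derivative_mult_right)
    also have "(\<Sum>j<d. \<eta> j * (poly (pderiv (monom 1 k)) (x j) * v j)) = - ?F k"
      using v[of "monom 1 k"] that by (simp add: degree_monom_eq poly_monom)
    finally have f: "(?f k has_vector_derivative - ?F k) (at 0)" .
    have "((\<lambda>s. ?f k s \<bullet> ?f k s) has_real_derivative - 2 * (?F k \<bullet> ?F k)) (at 0)"
      unfolding has_real_derivative_iff_has_vector_derivative
      by (rule has_vector_derivative_eq_rhs[OF bounded_bilinear.has_vector_derivative[OF bounded_bilinear_inner f f]]) simp
    then show ?thesis by (simp add: power2_norm_eq_inner)
  qed
  then show ?thesis
    unfolding residual_def sum_distrib_left by (intro DERIV_sum) auto
qed

text \<open>Any \<open>r\<close> below half the least distance between nodes works. This keeps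
  \<open>newton_direction\<close> applicable throughout a small box.\<close>

lemma nodes_separated:
  fixes e :: "nat \<Rightarrow> 'a :: metric_space"
  assumes "inj_on e I" "finite I"
  shows "\<forall>\<^sub>F r in at_right 0. \<forall>x. (\<forall>j\<in>I. dist (x j) (e j) \<le> r) \<longrightarrow> inj_on x I"
proof -
  have "\<forall>\<^sub>F r in at_right 0. i \<noteq> j \<longrightarrow> 2 * r < dist (e i) (e j)" if "i \<in> I" "j \<in> I" for i j
  proof (cases "i = j")
    case False
    then have "dist (e i) (e j) > 0" using assms that by (auto simp: inj_on_def)
    then show ?thesis
      unfolding eventually_at_right_field
      by (intro exI[of _ "dist (e i) (e j) / 2"]) auto
  qed simp
  then have "\<forall>\<^sub>F r in at_right 0. \<forall>i\<in>I. \<forall>j\<in>I. i \<noteq> j \<longrightarrow> 2 * r < dist (e i) (e j)"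
    using assms(2) by (intro eventually_ball_finite ballI) auto
  then show ?thesis
  proof (rule eventually_mono, intro allI impI inj_onI)
    fix r x i j
    assume r: "\<forall>i\<in>I. \<forall>j\<in>I. i \<noteq> j \<longrightarrow> 2 * r < dist (e i) (e j)"
      and x: "\<forall>j\<in>I. dist (x j) (e j) \<le> r" and ij: "i \<in> I" "j \<in> I" "x i = x j"
    have "dist (e i) (e j) \<le> dist (x i) (e i) + dist (x j) (e j)"
      using ij(3) dist_triangle3 by metis
    also have "\<dots> \<le> 2 * r"
      using bspec[OF x ij(1)] bspec[OF x ij(2)] by simp
    finally show "i = j" using r ij by fastforce
  qed
qed

section \<open>Openness and closedness of solvability\<close>

text \<open>Fixing two nodes removes the affine freedom, under which no solution would be isolated,
  and keeps the new solution nonconstant.\<close>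

lemma annihilates_open:
  fixes \<eta>0 e :: "nat \<Rightarrow> complex"
  assumes inj: "inj_on e {..<d}" and nz: "\<And>j. j < d \<Longrightarrow> \<eta>0 j \<noteq> 0" and ann: "annihilates d \<eta>0 e"
  shows "\<exists>U. open U \<and> \<eta>0 \<in> U \<and> (\<forall>\<eta>\<in>U. (\<Sum>j<d. \<eta> j) = 0 \<longrightarrow>
    (\<exists>x. x 0 = e 0 \<and> x 1 = e 1 \<and> annihilates d \<eta> x))"
proof -
  let ?I = "{2..<d}"
  have injI: "inj_on e ?I" using inj by (rule inj_on_subset) auto
  have "\<forall>\<^sub>F r in at_right (0::real). r > 0" by (simp add: eventually_at_right_less)
  then have "\<forall>\<^sub>F r in at_right 0. r > 0 \<and> (\<forall>x. (\<forall>j\<in>?I. dist (x j) (e j) \<le> r) \<longrightarrow> inj_on x ?I) \<and>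
    (\<forall>x. (\<forall>j. j \<notin> ?I \<longrightarrow> x j = e j) \<longrightarrow> (\<forall>j\<in>?I. dist (x j) (e j) \<le> r) \<longrightarrow> annihilates d \<eta>0 x \<longrightarrow> x = e)"
    using injI nz ann by (intro eventually_conj annihilated_isolated nodes_separated) auto
  from eventually_happens'[OF trivial_limit_at_right_real this]
  obtain r where r: "r > 0"
    and sep: "\<forall>x. (\<forall>j\<in>?I. dist (x j) (e j) \<le> r) \<longrightarrow> inj_on x ?I"
    and iso: "\<forall>x. (\<forall>j. j \<notin> ?I \<longrightarrow> x j = e j) \<longrightarrow> (\<forall>j\<in>?I. dist (x j) (e j) \<le> r) \<longrightarrow>
      annihilates d \<eta>0 x \<longrightarrow> x = e"
    by (elim exE conjE)
  define V where "V = {x. \<forall>j. x j \<in> (if j \<in> ?I then cball (e j) r else {e j})}"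
  \<comment> \<open>The boundary of the box in the free coordinates. By isolation, the residual for
    \<open>\<eta>0\<close> is positive on it.\<close>
  define S where "S = V \<inter> (\<Union>j\<in>?I. {x. dist (x j) (e j) = r})"
  have V: "x \<in> V \<longleftrightarrow> (\<forall>j. j \<notin> ?I \<longrightarrow> x j = e j) \<and> (\<forall>j\<in>?I. dist (x j) (e j) \<le> r)" for x
    unfolding V_def by (auto simp: dist_commute split: if_splits)
  have "compact V"
    unfolding V_def by (rule compact_function_box) simp
  moreover have "closed (\<Union>j\<in>?I. {x. dist (x j) (e j) = r})"
    by (intro closed_UN closed_Collect_eq continuous_intros ballI) auto
  ultimately have "compact S" unfolding S_def by (rule compact_Int_closed)
  \<comment> \<open>The centre \<open>e\<close> beats the boundary point strictly. Compactness of
    \<open>S\<close> makes this hold on all of \<open>S\<close> for every weight vector near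
    \<open>\<eta>0\<close>, which keeps minimisers off the boundary.\<close>
  define W where "W = {p. residual d (fst p) e < residual d (fst p) (snd p)}"
  have "open W"
    unfolding W_def by (intro open_Collect_less continuous_on_residual continuous_on_const continuous_on_fst continuous_on_snd continuous_on_id)
  moreover have "{\<eta>0} \<times> S \<subseteq> W"
  proof clarify
    fix x assume "x \<in> S"
    then have "x \<in> V" "x \<noteq> e" using r by (auto simp: S_def)
    then have "residual d \<eta>0 x \<noteq> 0" using iso V residual_eq_0_iff by blast
    moreover have "residual d \<eta>0 e = 0" using ann residual_eq_0_iff by blast
    ultimately show "(\<eta>0, x) \<in> W"
      unfolding W_def using residual_nonneg[of d \<eta>0 x] by simp
  qed
  ultimately have "\<exists>U. \<eta>0 \<in> U \<and> open U \<and> U \<times> S \<subseteq> W"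
    by (rule Elementary_Topology.tube_lemma[OF \<open>compact S\<close>])
  then obtain U where U: "\<eta>0 \<in> U" "open U" "U \<times> S \<subseteq> W"
    by (elim exE conjE)
  define U' where "U' = U \<inter> (\<Inter>j\<in>?I. {\<eta>. \<eta> j \<noteq> 0})"
  have "open U'"
    unfolding U'_def using U(2)
    by (intro open_Int open_INT open_Collect_neq continuous_intros ballI) auto
  moreover have "\<eta>0 \<in> U'" using U nz by (auto simp: U'_def)
  moreover have "\<exists>x. x 0 = e 0 \<and> x 1 = e 1 \<and> annihilates d \<eta> x"
    if "\<eta> \<in> U'" and s: "(\<Sum>j<d. \<eta> j) = 0" for \<eta>
  proof -
    have \<eta>: "\<eta> \<in> U" "\<And>j. j \<in> ?I \<Longrightarrow> \<eta> j \<noteq> 0" using that by (auto simp: U'_def)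
    have "e \<in> V" using r by (simp add: V)
    have "continuous_on V (residual d \<eta>)"
      using continuous_on_residual[of V "\<lambda>_. \<eta>" "\<lambda>x. x"] by simp
    then obtain x where x: "x \<in> V" "\<And>y. y \<in> V \<Longrightarrow> residual d \<eta> x \<le> residual d \<eta> y"
      using continuous_attains_inf[OF \<open>compact V\<close>] \<open>e \<in> V\<close> by blast
    have "x \<notin> S"
    proof
      assume "x \<in> S"
      then have "(\<eta>, x) \<in> W" using U \<eta> by blast
      then show False using x(2)[OF \<open>e \<in> V\<close>] by (simp add: W_def)
    qed
    have le: "\<forall>j\<in>?I. dist (x j) (e j) \<le> r" using x(1) by (simp add: V)
    have inside: "dist (x j) (e j) < r" if "j \<in> ?I" for j
    proof -
      have "dist (x j) (e j) \<noteq> r" using \<open>x \<notin> S\<close> x(1) that by (auto simp: S_def)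
      then show ?thesis using le that by (simp add: less_le)
    qed
    from le have "inj_on x ?I" by (rule sep[THEN spec, THEN mp])
    then obtain v where v: "\<And>j. j \<notin> ?I \<Longrightarrow> v j = 0"
      "\<And>p. degree p + 2 \<le> d \<Longrightarrow>
        (\<Sum>j<d. \<eta> j * (poly (pderiv p) (x j) * v j)) = - (\<Sum>j<d. \<eta> j * poly p (x j))"
      using newton_direction[of x d \<eta>] \<eta>(2) s by blast
    let ?y = "\<lambda>s j. x j + of_real s * v j"
    \<comment> \<open>Small moves along \<open>v\<close> stay in the box, so \<open>s = 0\<close> is
      a local minimum of the residual on this line.\<close>
    have "\<forall>\<^sub>F s in at (0::real). dist (?y s j) (e j) < r" if "j \<in> ?I" for j
    proof (rule order_tendstoD)
      show "((\<lambda>s. dist (?y s j) (e j)) \<longlongrightarrow> dist (?y 0 j) (e j)) (at (0::real))"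
        by (intro tendsto_intros)
      show "dist (?y 0 j) (e j) < r" using inside[OF that] by simp
    qed
    then have "\<forall>\<^sub>F s in at (0::real). \<forall>j\<in>?I. dist (?y s j) (e j) < r"
      by (intro eventually_ball_finite) auto
    then obtain \<delta> where \<delta>: "\<delta> > 0" "\<And>s. s \<noteq> 0 \<Longrightarrow> dist s 0 < \<delta> \<Longrightarrow> \<forall>j\<in>?I. dist (?y s j) (e j) < r"
      unfolding eventually_at by blast
    have "residual d \<eta> (?y 0) \<le> residual d \<eta> (?y s)" if "\<bar>0 - s\<bar> < \<delta>" for s
    proof (cases "s = 0")
      case False
      then have "\<forall>j\<in>?I. dist (?y s j) (e j) < r" using \<delta>(2) that by simp
      then have "?y s \<in> V" using x(1) v(1) by (auto simp: V intro: less_imp_le)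
      then show ?thesis using x(2) by simp
    qed simp
    then have "- 2 * residual d \<eta> x = 0"
      using DERIV_local_min[OF residual_along_newton_direction[OF v(2)] \<delta>(1)] by blast
    then have "annihilates d \<eta> x" by (simp add: residual_eq_0_iff)
    moreover have "x 0 = e 0" "x 1 = e 1" using x(1) by (simp_all add: V)
    ultimately show ?thesis by blast
  qed
  ultimately show ?thesis by blast
qed

text \<open>After normalisation the nodes range over a fixed compact set, and projecting a closed
  condition along a compact factor gives a closed set.\<close>

lemma annihilates_closed:
  "closed {\<eta>. \<exists>e. (\<exists>j<d. e j \<noteq> e 0) \<and> annihilates d \<eta> e}" (is "closed ?A")
proof -
  \<comment> \<open>Translation moves node 0 to the origin, and scaling makes the largest norm 1.
    The latter expresses nonconstancy as a closed condition.\<close>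
  define K :: "(nat \<Rightarrow> complex) set"
    where "K = {x. \<forall>j. x j \<in> (if j = 0 then {0} else cball 0 1)} \<inter> (\<Union>j<d. {x. norm (x j) = 1})"
  have "compact {x :: nat \<Rightarrow> complex. \<forall>j. x j \<in> (if j = 0 then {0} else cball 0 1)}"
    by (rule compact_function_box) simp
  moreover have "closed (\<Union>j<d. {x :: nat \<Rightarrow> complex. norm (x j) = 1})"
    by (intro closed_UN closed_Collect_eq continuous_intros ballI) auto
  ultimately have "compact K" unfolding K_def by (rule compact_Int_closed)
  have A: "?A = {\<eta>. \<exists>x\<in>K. annihilates d \<eta> x}"
  proof (intro set_eqI iffI; clarify)
    fix \<eta> e j assume j: "j < d" "e j \<noteq> e 0" and ann: "annihilates d \<eta> e"
    define M where "M = Max ((\<lambda>j. norm (e j - e 0)) ` {..<d})"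
    have le: "norm (e i - e 0) \<le> M" if "i < d" for i
      unfolding M_def using that by (intro Max_ge) auto
    then have "M > 0" using j(1) j(2) by (metis order_less_le_trans zero_less_norm_iff right_minus_eq)
    have "M \<in> (\<lambda>j. norm (e j - e 0)) ` {..<d}"
      unfolding M_def using j(1) by (intro Max_in) auto
    then obtain m where m: "m < d" "norm (e m - e 0) = M" by auto
    \<comment> \<open>The value 0 from index \<open>d\<close> on is invisible to
      \<open>annihilates\<close> but is needed for membership in \<open>K\<close>.\<close>
    define x where "x i = (if i < d then - e 0 / M + 1 / M * e i else 0)" for i
    have x: "x i = (if i < d then (e i - e 0) / M else 0)" for i
      by (simp add: x_def diff_divide_distrib)
    have "annihilates d \<eta> x"
      using annihilates_affine[OF ann, of "- e 0 / M" "1 / M"]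
      by (rule annihilates_cong[THEN iffD1, rotated]) (simp add: x_def)
    moreover have "x \<in> K"
      using m le \<open>M > 0\<close> by (auto simp: K_def x norm_divide)
    ultimately show "\<exists>x\<in>K. annihilates d \<eta> x" by blast
  next
    fix \<eta> x assume "x \<in> K" and ann: "annihilates d \<eta> x"
    then have "x 0 = 0" by (auto simp: K_def dest: spec[of _ 0])
    moreover obtain j where "j < d" "norm (x j) = 1" using \<open>x \<in> K\<close> by (auto simp: K_def)
    ultimately have "\<exists>j<d. x j \<noteq> x 0" by (intro exI[of _ j]) auto
    then show "\<exists>e. (\<exists>j<d. e j \<noteq> e 0) \<and> annihilates d \<eta> e" using ann by blast
  qed
  have nbhd: "\<exists>U. open U \<and> \<eta> \<in> U \<and> U \<subseteq> - ?A" if "\<eta> \<in> - ?A" for \<eta>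
  proof -
    let ?W = "{p. residual d (fst p) (snd p) \<noteq> 0}"
    have "open ?W"
      by (intro open_Collect_neq continuous_on_residual continuous_on_const continuous_on_fst continuous_on_snd continuous_on_id)
    moreover have "{\<eta>} \<times> K \<subseteq> ?W"
      using that unfolding A by (auto simp: residual_eq_0_iff)
    ultimately have "\<exists>U. \<eta> \<in> U \<and> open U \<and> U \<times> K \<subseteq> ?W"
      by (rule Elementary_Topology.tube_lemma[OF \<open>compact K\<close>])
    then obtain U where U: "\<eta> \<in> U" "open U" "U \<times> K \<subseteq> ?W"
      by (elim exE conjE)
    have "\<not> annihilates d \<zeta> x" if "\<zeta> \<in> U" "x \<in> K" for \<zeta> x
      using subsetD[OF U(3), of "(\<zeta>, x)"] that by (simp add: residual_eq_0_iff)
    then have "U \<subseteq> - ?A" unfolding A by blast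
    with U show ?thesis by blast
  qed
  have "open (- ?A)" by (rule open_subopen[THEN iffD2]) (intro ballI nbhd)
  then show ?thesis by (simp add: closed_def)
qed


section \<open>Distinct nodes and proportional weights\<close>

lemma annihilates_imp_inj:
  assumes d: "2 \<le> d" and nonconst: "\<exists>j<d. e j \<noteq> e 0" and ann: "annihilates d \<eta> e"
    and sub: "\<And>J. J \<noteq> {} \<Longrightarrow> J \<subset> {..<d} \<Longrightarrow> (\<Sum>j\<in>J. \<eta> j) \<noteq> 0"
  shows "inj_on e {..<d}"
proof (rule ccontr)
  assume "\<not> inj_on e {..<d}"
  then have "card (e ` {..<d}) \<noteq> card {..<d}"
    using eq_card_imp_inj_on[of "{..<d}" e] by blast
  then have card: "card (e ` {..<d}) < d"
    using card_image_le[of "{..<d}" e] by simp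
  \<comment> \<open>A collision anywhere lowers the number of values other than \<open>e 0\<close>
    to at most \<open>d - 2\<close>. The subset used is always the fibre of \<open>e 0\<close>,
    which is proper because \<open>e\<close> is nonconstant.\<close>
  let ?C = "e ` {..<d} - {e 0}"
  let ?p = "\<Prod>c\<in>?C. [:- c, 1:]"
  let ?J = "{j\<in>{..<d}. e j = e 0}"
  have "card ?C + 2 \<le> d" using card d by (simp add: card_Diff_singleton_if)
  moreover have "degree ?p \<le> card ?C"
    unfolding card_eq_sum by (rule order_trans[OF degree_prod_sum_le]) auto
  ultimately have "degree ?p + 2 \<le> d" by linarith
  then have sum0: "(\<Sum>j<d. \<eta> j * poly ?p (e j)) = 0"
    using ann unfolding annihilates_def by blast
  have "(\<Sum>j\<in>?J. \<eta> j) * poly ?p (e 0) = (\<Sum>j\<in>?J. \<eta> j * poly ?p (e j))"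
    unfolding sum_distrib_right by (intro sum.cong refl) simp
  also have "\<dots> = (\<Sum>j<d. \<eta> j * poly ?p (e j))"
    by (rule sum.mono_neutral_left) (auto simp: poly_prod prod_zero_iff)
  also note sum0
  finally have "(\<Sum>j\<in>?J. \<eta> j) = 0 \<or> poly ?p (e 0) = 0"
    by (simp only: mult_eq_0_iff)
  moreover have "poly ?p (e 0) \<noteq> 0"
    by (auto simp: poly_prod prod_zero_iff)
  ultimately have J0: "(\<Sum>j\<in>?J. \<eta> j) = 0" by blast
  have "0 \<in> ?J" using d by simp
  then have "?J \<noteq> {}" by blast
  moreover obtain j where "j < d" "e j \<noteq> e 0" using nonconst by blast
  then have "j \<in> {..<d} - ?J" by simp
  then have "?J \<subset> {..<d}" by blast
  ultimately show False using sub[of ?J] J0 by blast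
qed

text \<open>The products are the derivatives at the nodes of the monic polynomial with these zeros.
  Testing against the product over all nodes but \<open>i\<close> and \<open>j\<close> leaves two
  terms, and the missing factors \<open>e i - e j\<close> and \<open>e j - e i\<close> differ only
  in sign.\<close>

lemma annihilates_imp_weights_proportional:
  assumes ann: "annihilates d \<eta> e" and ij: "i < d" "j < d"
  shows "\<eta> i * (\<Prod>k\<in>{..<d} - {i}. e i - e k) = \<eta> j * (\<Prod>k\<in>{..<d} - {j}. e j - e k)"
proof (cases "i = j")
  case False
  let ?K = "{..<d} - {i, j}"
  let ?p = "\<Prod>k\<in>?K. [:- e k, 1:]"
  have "card ?K + 2 = d"
    using ij False by (simp add: card_Diff_subset)
  moreover have "degree ?p \<le> card ?K"
    unfolding card_eq_sum by (rule order_trans[OF degree_prod_sum_le]) auto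
  ultimately have "degree ?p + 2 \<le> d" by linarith
  then have "(\<Sum>k<d. \<eta> k * poly ?p (e k)) = 0"
    using ann unfolding annihilates_def by blast
  moreover have "(\<Sum>k<d. \<eta> k * poly ?p (e k)) = (\<Sum>k\<in>{i, j}. \<eta> k * poly ?p (e k))"
    using ij by (intro sum.mono_neutral_right) (auto simp: poly_prod prod_zero_iff)
  ultimately have eq: "\<eta> i * poly ?p (e i) = - (\<eta> j * poly ?p (e j))"
    using False by (simp add: eq_neg_iff_add_eq_0)
  have Di: "(\<Prod>k\<in>{..<d} - {i}. e i - e k) = (e i - e j) * poly ?p (e i)"
  proof -
    have *: "{..<d} - {i} = insert j ?K" using ij False by auto
    show ?thesis unfolding * by (subst prod.insert) (auto simp: poly_prod)
  qed
  have Dj: "(\<Prod>k\<in>{..<d} - {j}. e j - e k) = (e j - e i) * poly ?p (e j)"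
  proof -
    have *: "{..<d} - {j} = insert i ?K" using ij False by auto
    show ?thesis unfolding * by (subst prod.insert) (auto simp: poly_prod)
  qed
  have "\<eta> i * ((e i - e j) * poly ?p (e i)) = (e i - e j) * (\<eta> i * poly ?p (e i))"
    by (rule mult.left_commute)
  also have "\<dots> = \<eta> j * ((e j - e i) * poly ?p (e j))"
    unfolding eq by (simp add: algebra_simps)
  finally show ?thesis unfolding Di Dj .
qed simp

section \<open>Starting point and continuation\<close>

text \<open>For the zeros of \<open>w^d - 1\<close> the reciprocal derivative at a zero is that zero
  divided by \<open>d\<close>, so the weights are proportional to the nodes.\<close>

lemma annihilates_roots_of_unity:
  assumes "2 \<le> d"
  obtains \<rho> :: "nat \<Rightarrow> complex" where "inj_on \<rho> {..<d}" "\<And>j. \<rho> j \<noteq> 0" "annihilates d \<rho> \<rho>"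
proof
  define \<rho> where "\<rho> j = cis (2 * pi * real j / real d)" for j
  have bij: "bij_betw \<rho> {..<d} {z. z ^ d = 1}"
    using Complex.bij_betw_roots_unity[of d] assms unfolding \<rho>_def by simp
  then show inj: "inj_on \<rho> {..<d}" by (rule bij_betw_imp_inj_on)
  show "\<rho> j \<noteq> 0" for j by (simp add: \<rho>_def)
  show "annihilates d \<rho> \<rho>"
    unfolding annihilates_iff_power_sums
  proof (intro allI impI)
    fix k assume k: "k + 2 \<le> d"
    have "\<rho> (k + 1) \<noteq> \<rho> 0"
      using inj_onD[OF inj, of "k + 1" 0] k by auto
    then have "\<rho> (k + 1) \<noteq> 1" by (simp add: \<rho>_def)
    moreover have "\<rho> (k + 1) ^ d = 1"
      using bij_betwE[OF bij] k by simp
    \<comment> \<open>This turns the power sum into a geometric sum whose ratio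
      \<open>\<rho> (k + 1)\<close> is a root of unity other than 1.\<close>
    moreover have "\<rho> j * \<rho> j ^ k = \<rho> (k + 1) ^ j" for j
      unfolding \<rho>_def Complex.DeMoivre cis_mult by (rule arg_cong[where f = cis]) (simp add: algebra_simps add_divide_distrib)
    ultimately show "(\<Sum>j<d. \<rho> j * \<rho> j ^ k) = 0"
      by (simp add: geometric_sum)
  qed
qed

lemma annihilates_exists:
  fixes \<eta> :: "nat \<Rightarrow> complex"
  assumes d: "2 \<le> d" and s: "(\<Sum>j<d. \<eta> j) = 0"
    and sub: "\<And>J. J \<noteq> {} \<Longrightarrow> J \<subset> {..<d} \<Longrightarrow> (\<Sum>j\<in>J. \<eta> j) \<noteq> 0"
  shows "\<exists>e. (\<exists>j<d. e j \<noteq> e 0) \<and> annihilates d \<eta> e"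
proof -
  obtain \<rho> :: "nat \<Rightarrow> complex" where \<rho>: "inj_on \<rho> {..<d}" "\<And>j. \<rho> j \<noteq> 0" "annihilates d \<rho> \<rho>"
    using annihilates_roots_of_unity[OF d] by blast
  define A where "A = {\<eta>. \<exists>e. (\<exists>j<d. e j \<noteq> e 0) \<and> annihilates d \<eta> e}"
  define H where "H t j = (1 - t) * \<rho> j + t * \<eta> j" for t j
  have contH: "continuous_on S H" for S
    unfolding H_def by (intro continuous_on_coordinatewise_then_product continuous_intros)
  have "(\<Sum>j<d. \<rho> j) = 0"
    using \<rho>(3) d unfolding annihilates_iff_power_sums by (auto dest: spec[of _ 0])
  then have sumH: "(\<Sum>j<d. H t j) = 0" for t
    using s by (simp add: H_def sum.distrib sum_distrib_left[symmetric])
  \<comment> \<open>The exceptional parameters. Each subset sum is affine in \<open>t\<close> and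
    nonzero at \<open>t = 1\<close>, so it has at most one zero.\<close>
  define B where "B = (\<Union>J\<in>Pow {..<d} - {{}, {..<d}}. {t. (\<Sum>j\<in>J. H t j) = 0})"
  have "finite {t. (\<Sum>j\<in>J. H t j) = 0}" if J: "J \<noteq> {}" "J \<subset> {..<d}" for J
  proof -
    let ?r = "\<Sum>j\<in>J. \<rho> j" and ?h = "\<Sum>j\<in>J. \<eta> j"
    have "t = ?r / (?r - ?h)" if "(\<Sum>j\<in>J. H t j) = 0" for t
    proof -
      have "(1 - t) * ?r + t * ?h = 0"
        using that by (simp add: H_def sum.distrib sum_distrib_left[symmetric])
      then have *: "t * (?r - ?h) = ?r" by (simp add: algebra_simps)
      then have "?r - ?h \<noteq> 0" using sub[OF J] by auto
      then show ?thesis using * by (simp add: field_simps)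
    qed
    then have "{t. (\<Sum>j\<in>J. H t j) = 0} \<subseteq> {?r / (?r - ?h)}" by blast
    then show ?thesis using finite_subset by blast
  qed
  then have finB: "finite B" unfolding B_def by (intro finite_UN_I) auto
  have good: "(\<Sum>j\<in>J. H t j) \<noteq> 0" if "t \<in> - B" "J \<noteq> {}" "J \<subset> {..<d}" for t J
    using that unfolding B_def by auto
  have H1: "H 1 = \<eta>" "H 0 = \<rho>" by (auto simp: H_def)
  have "1 \<in> - B" using sub H1 by (auto simp: B_def)
  \<comment> \<open>Stated without \<open>t \<in> - B\<close>, because it is also applied at
    \<open>t = 0\<close>, which may be exceptional: for \<open>d = 4\<close>, opposite roots of
    unity sum to 0.\<close>
  have nbhd: "\<exists>T. open T \<and> t \<in> T \<and> H ` T \<subseteq> A"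
    if e: "inj_on e {..<d}" "\<And>j. j < d \<Longrightarrow> H t j \<noteq> 0" "annihilates d (H t) e" for t e
  proof -
    obtain U where U: "open U" "H t \<in> U"
      "\<And>\<eta>. \<eta> \<in> U \<Longrightarrow> (\<Sum>j<d. \<eta> j) = 0 \<Longrightarrow> \<exists>x. x 0 = e 0 \<and> x 1 = e 1 \<and> annihilates d \<eta> x"
      using annihilates_open[OF e] by blast
    have "e 1 \<noteq> e 0" using inj_onD[OF e(1), of 1 0] d by auto
    have "H u \<in> A" if u: "H u \<in> U" for u
    proof -
      obtain x where "x 0 = e 0" "x 1 = e 1" "annihilates d (H u) x"
        using U(3)[OF u sumH] by blast
      then show ?thesis
        unfolding A_def using \<open>e 1 \<noteq> e 0\<close> d by (intro CollectI exI[of _ x] conjI exI[of _ 1]) auto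
    qed
    moreover have "open (H -` U)" by (rule open_vimage[OF U(1) contH])
    ultimately show ?thesis using U(2) by (intro exI[of _ "H -` U"]) auto
  qed
  define T where "T = - B \<inter> H -` A"
  \<comment> \<open>The parameter is complex for this reason: removing finitely many points does not
    disconnect the plane.\<close>
  have "connected (- B)"
    using finB by (intro path_connected_imp_connected path_connected_complement_countable)
      (auto simp: countable_finite)
  moreover have "closedin (top_of_set (- B)) T"
    unfolding T_def by (intro closedin_closed_Int closed_vimage contH)
      (use annihilates_closed[of d] in \<open>simp add: A_def\<close>)
  moreover have "openin (top_of_set (- B)) T"
  proof (subst openin_subopen, intro ballI)
    fix t assume t: "t \<in> T"
    then obtain e where e: "\<exists>j<d. e j \<noteq> e 0" "annihilates d (H t) e"
      by (auto simp: T_def A_def)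
    have "t \<in> - B" using t by (simp add: T_def)
    have "inj_on e {..<d}"
      using annihilates_imp_inj[OF d e good[OF \<open>t \<in> - B\<close>]] .
    moreover have "H t j \<noteq> 0" if "j < d" for j
    proof -
      have "card {j} \<noteq> card {..<d}" using d by simp
      then have "{j} \<noteq> {..<d}" by metis
      then show ?thesis using good[OF \<open>t \<in> - B\<close>, of "{j}"] that by auto
    qed
    ultimately obtain V where V: "open V" "t \<in> V" "H ` V \<subseteq> A"
      using nbhd e(2) by blast
    then have "openin (top_of_set (- B)) (- B \<inter> V)" "t \<in> - B \<inter> V" "- B \<inter> V \<subseteq> T"
      using \<open>t \<in> - B\<close> by (auto simp: T_def)
    then show "\<exists>V. openin (top_of_set (- B)) V \<and> t \<in> V \<and> V \<subseteq> T" by blast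
  qed
  moreover have "T \<noteq> {}"
  proof -
    obtain V where V: "open V" "0 \<in> V" "H ` V \<subseteq> A"
      using nbhd[of \<rho> 0] \<rho> H1 by auto
    \<comment> \<open>As 0 itself may lie in \<open>B\<close>, a nearby parameter outside the finite
      set \<open>B\<close> is taken instead.\<close>
    have "infinite V" using V(1,2) finite_imp_not_open by blast
    then have "\<not> V \<subseteq> B" using finite_subset[OF _ finB] by blast
    then obtain t where "t \<in> V" "t \<notin> B" by blast
    then have "t \<in> T" using V(3) by (auto simp: T_def)
    then show ?thesis by blast
  qed
  ultimately have "T = - B" unfolding connected_clopen by blast
  then have "1 \<in> T" using \<open>1 \<in> - B\<close> by blast
  then show ?thesis by (simp add: T_def A_def H1)
qed

section \<open>Rescaling to the prescribed derivatives\<close>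

theorem theorem1p1:
  fixes d :: nat and \<eta> :: "nat \<Rightarrow> complex"
  assumes "d \<ge> 2"
    and "\<And>j. j < d \<Longrightarrow> \<eta> j \<noteq> 0"
    and "(\<Sum>j<d. \<eta> j) = 0"
    and "\<And>J. J \<noteq> {} \<Longrightarrow> J \<subset> {..<d} \<Longrightarrow> (\<Sum>j\<in>J. \<eta> j) \<noteq> 0"
  shows "\<exists>(f :: complex poly) (e :: nat \<Rightarrow> complex).
           lead_coeff f = 1 \<and> degree f = d \<and>
           f = (\<Prod>j<d. [:- e j, 1:]) \<and>
           inj_on e {..<d} \<and>
           (\<forall>j<d. poly (pderiv f) (e j) = 1 / \<eta> j)"
proof -
  obtain e where e: "\<exists>j<d. e j \<noteq> e 0" "annihilates d \<eta> e"
    using annihilates_exists[OF assms(1,3,4)] by blast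
  have inj: "inj_on e {..<d}"
    using annihilates_imp_inj[OF assms(1) e assms(4)] .
  let ?D = "\<lambda>e j. \<Prod>k\<in>{..<d} - {j}. e j - e k :: complex"
  define c where "c = \<eta> 0 * ?D e 0"
  have weights: "\<eta> j * ?D e j = c" if "j < d" for j
    unfolding c_def using annihilates_imp_weights_proportional[OF e(2) that] assms(1) by simp
  have "?D e 0 \<noteq> 0" using inj assms(1) by (auto simp: prod_zero_iff inj_on_def)
  then have "c \<noteq> 0" using assms(1,2) by (simp add: c_def)
  \<comment> \<open>Scaling the nodes by \<open>\<mu>\<close> multiplies each product of
    \<open>d - 1\<close> differences by \<open>\<mu> ^ (d - 1)\<close>, and this factor must turn
    \<open>c\<close> into 1.\<close>
  then have "1 / c \<noteq> 0" "d - 1 \<noteq> 0" using assms(1) by auto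
  then obtain \<mu> where \<mu>: "\<mu> \<noteq> 0" "1 / c = \<mu> ^ (d - 1)"
    by (rule exists_complex_root_nonzero)
  define x where "x j = \<mu> * e j" for j
  have injx: "inj_on x {..<d}"
    using inj \<mu>(1) by (simp add: x_def inj_on_def)
  define f where "f = (\<Prod>j<d. [:- x j, 1:])"
  have deriv: "poly (pderiv f) (x j) = 1 / \<eta> j" if j: "j < d" for j
  proof -
    have "poly (pderiv f) (x j) = (\<Sum>i<d. \<Prod>k\<in>{..<d} - {i}. x j - x k)"
      by (simp add: f_def pderiv_prod poly_sum poly_prod pderiv_pCons)
    also have "\<dots> = (\<Sum>i<d. if i = j then ?D x j else 0)"
      by (intro sum.cong refl) (use j in \<open>auto simp: prod_zero_iff\<close>)
    also have "\<dots> = ?D x j" using j by simp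
    also have "\<dots> = \<mu> ^ (d - 1) * ?D e j"
      using j by (simp add: x_def right_diff_distrib[symmetric] prod.distrib)
    also have "\<dots> = 1 / \<eta> j"
      unfolding \<mu>(2)[symmetric]
      using weights[OF j] \<open>c \<noteq> 0\<close> assms(2)[OF j] by (simp add: field_simps)
    finally show ?thesis .
  qed
  have lead: "lead_coeff f = 1" unfolding f_def lead_coeff_prod by simp
  have deg: "degree f = d" unfolding f_def by (subst degree_prod_eq_sum_degree) simp_all
  show ?thesis
    by (intro exI[of _ f] exI[of _ x] conjI allI impI lead deg f_def injx deriv)
qed

end
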